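(* Let $K$ be an even integer and $x\ge1$ an integer. Then $\pi_K(2^x)=\alpha_K(2^x)=2^{\,x+1-\nu_2(\gcd(2^x,K))}$ and $\omega_K(2^x)=1$.
   Context: $\nu_2$ denotes the 2-adic valuation. For an integer $K$, the $K$-Fibonacci sequence is $F_{K,0}=0$, $F_{K,1}=1$, $F_{K,n}=KF_{K,n-1}+F_{K,n-2}$ for $n\ge2$. For an integer $m\ge 2$, $\pi_K(m)$ is the least positive period of $(F_{K,n}\bmod m)$, $\alpha_K(m)$ is the least positive index $n$ with $m\mid F_{K,n}$, and $\omega_K(m)$ is the number of indices $0\le n<\pi_K(m)$ with $m\mid F_{K,n}$. *)

theory Defs
  imports "HOL-Number_Theory.Number_Theory"
begin

fun kfib :: "int \<Rightarrow> nat \<Rightarrow> int" where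
  "kfib K 0 = 0"
| "kfib K (Suc 0) = 1"
| "kfib K (Suc (Suc n)) = K * kfib K (Suc n) + kfib K n"

(* Periods are pure (the repetition starts at index 0): the recurrence can be run
   backwards modulo m, so the sequence has no preperiod. *)
definition kfib_period :: "int \<Rightarrow> nat \<Rightarrow> nat" where
  "kfib_period K m =
     (LEAST p. 0 < p \<and> (\<forall>n. kfib K (n + p) mod int m = kfib K n mod int m))"

definition kfib_entry :: "int \<Rightarrow> nat \<Rightarrow> nat" where
  "kfib_entry K m = (LEAST n. 0 < n \<and> int m dvd kfib K n)"

definition kfib_zeros :: "int \<Rightarrow> nat \<Rightarrow> nat" where
  "kfib_zeros K m = card {n. n < kfib_period K m \<and> int m dvd kfib K n}"

end

(* Write K = 2^e c with e >= 1, where 2^e = gcd (2^x, K), so c is odd or x = e. The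
   doubling formulas F(2n) = F(n) (2 F(n+1) - K F(n)) and F(2n+1) = F(n+1)^2 + F(n)^2 give,
   by induction on j, that 2^(j+1) is a period modulo 2^(e+j), and that
   F(2^(j+1)) = 2^(e+j) d with d odd if c is odd. Hence F(n) is divisible by 2^(e+j) only if
   2^(j+1) divides n: an odd multiple n of 2^(j+1) satisfies F(n) = F(2^(j+1)) modulo
   2^(e+j+1), which is nonzero. *)
theory Submission
  imports Defs
begin

text \<open>\<open>n\<close> is left arbitrary because the induction step moves one unit from
  \<open>m\<close> to \<open>n\<close>, where the recurrence absorbs it.\<close>

lemma kfib_add: "kfib K (Suc (m + n)) = kfib K (Suc m) * kfib K (Suc n) + kfib K m * kfib K n"
proof (induction m arbitrary: n)
  case (Suc m)
  show ?case
    using Suc.IH[of "Suc n"] by (simp add: algebra_simps)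
qed simp

lemma kfib_double: "kfib K (2 * n) = kfib K n * (2 * kfib K (Suc n) - K * kfib K n)"
proof (cases n)
  case (Suc k)
  have "kfib K (2 * n) = kfib K (Suc (k + n))"
    by (simp add: Suc mult_2)
  also have "\<dots> = kfib K (Suc k) * kfib K (Suc n) + kfib K k * kfib K n"
    by (rule kfib_add)
  finally show ?thesis
    by (simp add: Suc algebra_simps)
qed simp

lemma kfib_double_Suc: "kfib K (Suc (2 * n)) = (kfib K (Suc n))\<^sup>2 + (kfib K n)\<^sup>2"
  using kfib_add[of K n n] by (simp add: power2_eq_square mult_2)

text \<open>The residues at \<open>N\<close> and \<open>Suc N\<close> repeat the initial values 0,
  1, so the addition formula collapses to its first term.\<close>

lemma kfib_cong_add:
  assumes "[kfib K N = 0] (mod m)" and "[kfib K (Suc N) = 1] (mod m)"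
  shows "[kfib K (n + N) = kfib K n] (mod m)"
proof (cases n)
  case (Suc k)
  have "[kfib K (Suc k) * kfib K (Suc N) + kfib K k * kfib K N
      = kfib K (Suc k) * 1 + kfib K k * 0] (mod m)"
    by (intro cong_add cong_mult cong_refl assms)
  then show ?thesis
    using kfib_add[of K k N] by (simp add: Suc)
qed (use assms in simp)

lemma kfib_cong_add_mult:
  assumes "[kfib K N = 0] (mod m)" and "[kfib K (Suc N) = 1] (mod m)"
  shows "[kfib K (n + q * N) = kfib K n] (mod m)"
proof (induction q)
  case (Suc q)
  have "[kfib K ((n + q * N) + N) = kfib K (n + q * N)] (mod m)"
    by (rule kfib_cong_add[OF assms])
  then show ?case
    using Suc.IH by (auto simp: algebra_simps intro: cong_trans)
qed simp

text \<open>For even \<open>K\<close> the recurrence modulo 2 is F(n+2) = F(n). This supplies the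
  base case of the divisibility criterion.\<close>

lemma even_kfib_iff:
  assumes "even K"
  shows "even (kfib K n) \<longleftrightarrow> even n"
  using assms by (induction K n rule: kfib.induct) simp_all

text \<open>Both values are carried through one induction, since doubling either index uses both.
  The factor 2 F(n+1) - K F(n) is twice an odd number, so each doubling gains exactly one factor
  2.\<close>

lemma kfib_power_2:
  fixes c :: int
  assumes K: "K = 2 ^ e * c" and e: "e \<ge> 1"
  shows "\<exists>d t. kfib K (2 ^ Suc j) = 2 ^ (e + j) * d \<and> (odd c \<longrightarrow> odd d)
    \<and> kfib K (Suc (2 ^ Suc j)) = 1 + 2 ^ (e + j) * t"
proof (induction j)
  case 0
  show ?case
    \<comment> \<open>F(2) = K = 2^e c and F(3) = K^2 + 1 = 1 + 2^e (c K).\<close>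
    by (rule exI[of _ c], rule exI[of _ "c * K"]) (simp add: K numeral_2_eq_2 mult_ac)
next
  case (Suc j)
  define n :: nat where "n = 2 ^ Suc j"
  obtain d t where d: "kfib K n = 2 ^ (e + j) * d" "odd c \<longrightarrow> odd d"
    and t: "kfib K (Suc n) = 1 + 2 ^ (e + j) * t"
    using Suc.IH unfolding n_def by blast
  \<comment> \<open>Splitting one 2 off 2^e writes the old modulus as 2u and the new one as 4u;
    squares of multiples of 2u are then visibly multiples of 4u.\<close>
  obtain i where i: "e = Suc i"
    using e by (cases e) auto
  define u :: int where "u = 2 ^ (i + j)"
  have u: "2 ^ (e + j) = 2 * u" "2 ^ (e + Suc j) = 4 * u"
    by (simp_all add: u_def i)
  define d' where "d' = d * (1 + 2 * u * t - 2 ^ e * c * u * d)"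
  define t' where "t' = t + u * t\<^sup>2 + u * d\<^sup>2"
  have "kfib K (2 * n) = 2 * u * d * (2 * (1 + 2 * u * t) - 2 ^ e * c * (2 * u * d))"
    unfolding kfib_double d t u by (simp add: K)
  also have "\<dots> = 4 * u * d'"
    by (simp add: d'_def algebra_simps)
  finally have "kfib K (2 * n) = 4 * u * d'" .
  \<comment> \<open>The second factor of \<open>d'\<close> is 1 plus even terms, because e is at
    least 1.\<close>
  moreover have "odd c \<longrightarrow> odd d'"
    using d e by (simp add: d'_def)
  moreover have "kfib K (Suc (2 * n)) = 1 + 4 * u * t'"
    unfolding kfib_double_Suc d t u t'_def by (simp add: algebra_simps power2_eq_square)
  moreover have "2 * n = 2 ^ Suc (Suc j)"
    by (simp add: n_def)
  ultimately show ?case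
    unfolding u by metis
qed

lemma kfib_power_2_cong:
  fixes c :: int
  assumes "K = 2 ^ e * c" and "e \<ge> 1"
  shows "[kfib K (2 ^ Suc j) = 0] (mod 2 ^ (e + j))"
    and "[kfib K (Suc (2 ^ Suc j)) = 1] (mod 2 ^ (e + j))"
  using kfib_power_2[OF assms, of j] by (auto simp: cong_iff_dvd_diff)

text \<open>The case \<open>j = 0\<close> admits even \<open>c\<close>, which can occur when 2^x
  divides K (for instance K = 0); the forward direction is then a matter of parity.\<close>

lemma power_2_dvd_kfib_iff:
  fixes c :: int
  assumes K: "K = 2 ^ e * c" and e: "e \<ge> 1" and c: "odd c \<or> j = 0"
  shows "2 ^ (e + j) dvd kfib K n \<longleftrightarrow> 2 ^ Suc j dvd n"
proof
  assume "2 ^ Suc j dvd n"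
  then obtain q where "n = 0 + q * 2 ^ Suc j"
    by (auto simp: mult.commute elim: dvdE)
  then have "[kfib K n = 0] (mod 2 ^ (e + j))"
    using kfib_cong_add_mult[OF kfib_power_2_cong[OF K e], of 0 q j] by (simp del: power_Suc)
  then show "2 ^ (e + j) dvd kfib K n"
    by (simp add: cong_0_iff)
next
  assume "2 ^ (e + j) dvd kfib K n"
  then show "2 ^ Suc j dvd n"
    using c
  proof (induction j)
    case 0
    have "(2 :: int) dvd 2 ^ e"
      using e by simp
    then have "even (kfib K n)"
      using 0 by (metis add_0_right dvd_trans)
    then show ?case
      using even_kfib_iff[of K n] K e by simp
  next
    case (Suc j)
    then have "odd c" by simp
    \<comment> \<open>Weakening the divisibility makes the induction hypothesis applicable; only an
      odd cofactor \<open>m\<close> remains to be excluded.\<close>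
    have "2 ^ (e + j) dvd kfib K n"
      using Suc.prems(1) by (rule dvd_trans[rotated]) (simp add: le_imp_power_dvd)
    then obtain m where m: "n = 2 ^ Suc j * m"
      using Suc.IH \<open>odd c\<close> by (auto elim: dvdE)
    have "even m"
    proof (rule ccontr)
      assume "odd m"
      then obtain q where "m = 2 * q + 1"
        by (rule oddE)
      then have n: "n = 2 ^ Suc j + q * 2 ^ Suc (Suc j)"
        by (simp add: m algebra_simps)
      have "[kfib K n = kfib K (2 ^ Suc j)] (mod 2 ^ (e + Suc j))"
        unfolding n by (rule kfib_cong_add_mult[OF kfib_power_2_cong[OF K e]])
      then have "2 ^ (e + Suc j) dvd kfib K (2 ^ Suc j)"
        using Suc.prems(1) cong_dvd_iff cong_sym by blast
      moreover obtain d where "kfib K (2 ^ Suc j) = 2 ^ (e + j) * d" "odd d"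
        using kfib_power_2[OF K e, of j] \<open>odd c\<close> by blast
      \<comment> \<open>Cancelling 2^(e+j) would make the odd number \<open>d\<close> even.\<close>
      ultimately show False
        by (simp add: mult.commute)
    qed
    then show ?case
      by (auto simp: m)
  qed
qed

theorem theorem4p28:
  fixes K :: int and x :: nat
  assumes "even K" and "x \<ge> 1"
  shows "kfib_period K (2 ^ x) = kfib_entry K (2 ^ x)
    \<and> kfib_entry K (2 ^ x) = 2 ^ (x + 1 - multiplicity 2 (gcd (2 ^ x) K))
    \<and> kfib_zeros K (2 ^ x) = 1"
proof -
  define e where "e = multiplicity 2 (gcd (2 ^ x) K)"
  define N :: nat where "N = 2 ^ (x + 1 - e)"
  have "2 ^ e dvd gcd (2 ^ x) K"
    unfolding e_def by (rule multiplicity_dvd)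
  then have dvd: "(2 :: int) ^ e dvd 2 ^ x" "2 ^ e dvd K"
    by simp_all
  from dvd(1) have "e \<le> x"
    by (simp add: dvd_power_iff)
  obtain c where K: "K = 2 ^ e * c"
    using dvd(2) by (elim dvdE)
  have "2 ^ 1 dvd gcd (2 ^ x) K"
    using assms by simp
  then have e: "e \<ge> 1"
    unfolding e_def by (intro multiplicity_geI) auto
  \<comment> \<open>Otherwise 2^(e+1) would divide both 2^x and K, against the maximality of
    \<open>e\<close>.\<close>
  have c: "odd c \<or> x - e = 0"
  proof (rule ccontr)
    assume "\<not> (odd c \<or> x - e = 0)"
    then have "even c" and "Suc e \<le> x"
      by simp_all
    then have "2 ^ Suc e dvd K" and "(2 :: int) ^ Suc e dvd 2 ^ x"
      by (auto simp: K mult.commute simp del: power_Suc intro: le_imp_power_dvd)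
        (auto elim: dvdE)
    then have "2 ^ Suc e dvd gcd (2 ^ x) K"
      by (rule gcd_greatest[rotated])
    then have "Suc e \<le> multiplicity 2 (gcd (2 ^ x) K)"
      by (intro multiplicity_geI) auto
    then show False
      by (simp add: e_def)
  qed
  \<comment> \<open>The lemmas are used with j = x - e, so that the modulus is 2^x and the index is
    \<open>N\<close>.\<close>
  have x: "e + (x - e) = x" and N: "2 ^ Suc (x - e) = N"
    using \<open>e \<le> x\<close> by (simp_all add: N_def Suc_diff_le)
  have "N > 0"
    by (simp add: N_def)
  have zero_iff: "int (2 ^ x) dvd kfib K n \<longleftrightarrow> N dvd n" for n
    using power_2_dvd_kfib_iff[OF K e c, of n] unfolding x N by simp
  have cong: "[kfib K N = 0] (mod 2 ^ x)" "[kfib K (Suc N) = 1] (mod 2 ^ x)"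
    using kfib_power_2_cong[OF K e, of "x - e"] unfolding x N by auto
  have entry: "kfib_entry K (2 ^ x) = N"
    unfolding kfib_entry_def zero_iff
    using \<open>N > 0\<close> by (intro Least_equality) (auto dest: dvd_imp_le)
  have period: "kfib_period K (2 ^ x) = N"
    unfolding kfib_period_def
  proof (rule Least_equality)
    show "0 < N \<and> (\<forall>n. kfib K (n + N) mod int (2 ^ x) = kfib K n mod int (2 ^ x))"
      using \<open>N > 0\<close> kfib_cong_add[OF cong] by (simp add: cong_def)
  next
    fix p
    assume p: "0 < p \<and> (\<forall>n. kfib K (n + p) mod int (2 ^ x) = kfib K n mod int (2 ^ x))"
    \<comment> \<open>Comparing indices 0 and p shows that every period is the index of a zero,
      hence a multiple of \<open>N\<close>.\<close>
    then have "kfib K (0 + p) mod int (2 ^ x) = kfib K 0 mod int (2 ^ x)"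
      by blast
    then have "int (2 ^ x) dvd kfib K p"
      by (simp add: mod_eq_0_iff_dvd)
    then show "N \<le> p"
      using p unfolding zero_iff by (simp add: dvd_imp_le)
  qed
  have "{n. n < N \<and> N dvd n} = {0}"
    using \<open>N > 0\<close> by (auto dest: dvd_imp_le)
  then have "kfib_zeros K (2 ^ x) = 1"
    unfolding kfib_zeros_def period zero_iff by simp
  then show ?thesis
    using period entry by (simp add: N_def e_def)
qed

end
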